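(* Let $p=(p(1),\ldots,p(k))$ be a probability vector with non-zero entries, i.e. $p(i)>0$ for $i=1,\ldots,k$ and $\sum_{i=1}^k p(i)=1$, and let $(\Sigma_{k},\mathfrak{B}_{k},\mu_{p},S_k)$ be the Bernoulli shift associated to $p$. Then, for any integer $n\geq 1$, the shift map $S_k$ (with respect to $\mu_p$) is not AT$(n)$.
   Context: AT$(n)$: Let $T$ be a measure preserving automorphism (invertible measure preserving transformation) of a standard probability space $(X,\mathfrak{B},\mu)$, and let $L^1_+(X,\mu)$ be the set of nonnegative functions in $L^1(X,\mu)$. For an integer $n\ge 1$, the system $(X,\mathfrak{B},\mu,T)$ (or simply $T$) is AT$(n)$ if for every $\varepsilon>0$ and every finite set of functions $f_1,\ldots,f_r\in L^1_+(X,\mu)$ there exist $n$ functions $g_1,\ldots,g_n\in L^1_+(X,\mu)$, a positive integer $N$, nonnegative reals $\alpha_{i,j}^{(m)}$ ($1\le m\le n$, $1\le i\le r$, $1\le j\le N$) and integers $t_j^{(m)}$ ($1\le m\le n$, $1\le j\le N$) such that \[\Big\|f_{i}-\sum_{m=1}^{n}\sum_{j=1}^{N}\alpha_{i,j}^{(m)}\,g_{m}\circ T^{t_{j}^{(m)}}\Big\|_{1}<\varepsilon\quad\text{for } i=1,\ldots,r.\] Bernoulli shift: $\Sigma_k=\{1,\ldots,k\}^{\mathbb{Z}}$ is the shift space over the alphabet $\{1,\ldots,k\}$, $\mathfrak{B}_k$ is the $\sigma$-algebra generated by the cylinder sets $[y_0,\ldots,y_m]_n=\{x\in\Sigma_k: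 x_n=y_0,\ldots,x_{n+m}=y_m\}$ (with $m,n\in\mathbb{Z}$, $m\ge 0$, $y_i\in\{1,\ldots,k\}$), $S_k:\Sigma_k\to\Sigma_k$ is given by $(S_kx)_n=x_{n+1}$, and $\mu_p$ is the unique probability measure on $(\Sigma_k,\mathfrak{B}_k)$ with $\mu_p([y_0,\ldots,y_m]_n)=p(y_0)p(y_1)\cdots p(y_m)$ for all cylinder sets.
   Formalization: The alphabet size is assumed to be k ≥ 2; for k = 1 the space Σ_1 is a single point, S_1 is the identity, and it is AT(n) for every n (take each g_m = 1), so the claim fails there. *)

theory Defs
  imports "HOL-Probability.Probability"
begin

section \<open>Measure preserving automorphisms and the property AT(n)\<close>

text \<open>
  Bijectivity is required on the whole space rather than modulo null sets; the shift satisfies this.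
\<close>
locale mp_automorphism = prob_space M for M :: "'a measure" +
  fixes T :: "'a \<Rightarrow> 'a"
  assumes bij: "bij_betw T (space M) (space M)"
    and measurable_T: "T \<in> measurable M M"
    and measurable_inv: "inv_into (space M) T \<in> measurable M M"
    and distr_T: "distr M M T = M"

text \<open>The iterate \<open>T\<^sup>t\<close> for integer \<open>t\<close>; meaningful when \<open>T\<close> is a bijection of \<^term>\<open>space M\<close>.\<close>
definition int_iter :: "'a measure \<Rightarrow> ('a \<Rightarrow> 'a) \<Rightarrow> int \<Rightarrow> 'a \<Rightarrow> 'a" where
  "int_iter M T t =
    (if 0 \<le> t then T ^^ nat t else inv_into (space M) T ^^ nat (- t))"

text \<open>Representatives of the elements of \<open>L\<^sup>1\<^sub>+(M)\<close>, hence nonnegativity almost everywhere.\<close>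
definition L1_pos :: "'a measure \<Rightarrow> ('a \<Rightarrow> real) set" where
  "L1_pos M = {f. integrable M f \<and> (AE x in M. 0 \<le> f x)}"

definition L1_norm :: "'a measure \<Rightarrow> ('a \<Rightarrow> real) \<Rightarrow> real" where
  "L1_norm M f = (\<integral>x. \<bar>f x\<bar> \<partial>M)"

text \<open>
  To be used only for \<open>M\<close> and \<open>T\<close> satisfying \<^locale>\<open>mp_automorphism\<close>: then every function
  whose \<^const>\<open>L1_norm\<close> is taken below is integrable.
  The arguments of \<open>\<alpha>\<close> are ordered \<open>m\<close>, \<open>i\<close>, \<open>j\<close>.
\<close>
definition AT :: "nat \<Rightarrow> 'a measure \<Rightarrow> ('a \<Rightarrow> 'a) \<Rightarrow> bool" where
  "AT n M T \<longleftrightarrow>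
    (\<forall>\<epsilon>>0. \<forall>r::nat. \<forall>f :: nat \<Rightarrow> 'a \<Rightarrow> real. (\<forall>i\<in>{1..r}. f i \<in> L1_pos M) \<longrightarrow>
      (\<exists>(g :: nat \<Rightarrow> 'a \<Rightarrow> real) (N::nat) (\<alpha> :: nat \<Rightarrow> nat \<Rightarrow> nat \<Rightarrow> real) (t :: nat \<Rightarrow> nat \<Rightarrow> int).
        (\<forall>m\<in>{1..n}. g m \<in> L1_pos M) \<and> 1 \<le> N \<and>
        (\<forall>m\<in>{1..n}. \<forall>i\<in>{1..r}. \<forall>j\<in>{1..N}. 0 \<le> \<alpha> m i j) \<and>
        (\<forall>i\<in>{1..r}.
          L1_norm M (\<lambda>x. f i x - (\<Sum>m=1..n. \<Sum>j=1..N. \<alpha> m i j * g m (int_iter M T (t m j) x))) < \<epsilon>)))"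


section \<open>Bernoulli shifts\<close>

definition shift_space :: "nat \<Rightarrow> (int \<Rightarrow> nat) set" where
  "shift_space k = {x. \<forall>i. x i \<in> {1..k}}"

definition shift_map :: "(int \<Rightarrow> nat) \<Rightarrow> int \<Rightarrow> nat" where
  "shift_map x = (\<lambda>i. x (i + 1))"

text \<open>The cylinder \<open>[y\<^sub>0, \<dots>, y\<^sub>m]\<^sub>n\<close>.\<close>
definition cylinder :: "nat \<Rightarrow> nat \<Rightarrow> (nat \<Rightarrow> nat) \<Rightarrow> int \<Rightarrow> (int \<Rightarrow> nat) set" where
  "cylinder k m y n = {x \<in> shift_space k. \<forall>j\<le>m. x (n + int j) = y j}"

definition cylinders :: "nat \<Rightarrow> (int \<Rightarrow> nat) set set" where
  "cylinders k = {cylinder k m y n | m y n. \<forall>j\<le>m. y j \<in> {1..k}}"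

text \<open>
  The Bernoulli measure as a product measure. The lemmas below show that its \<open>\<sigma>\<close>-algebra is
  generated by the cylinders and that it has the prescribed values on them.
\<close>
definition bernoulli :: "nat \<Rightarrow> (nat \<Rightarrow> real) \<Rightarrow> (int \<Rightarrow> nat) measure" where
  "bernoulli k p = (\<Pi>\<^sub>M i\<in>UNIV. point_measure {1..k} (\<lambda>a. ennreal (p a)))"

lemma space_bernoulli: "space (bernoulli k p) = shift_space k"
  by (auto simp: bernoulli_def space_PiM space_point_measure shift_space_def PiE_def Pi_def extensional_def)

lemma sets_bernoulli: "sets (bernoulli k p) = sigma_sets (shift_space k) (cylinders k)"
proof -
  have PiE_eq: "(\<Pi>\<^sub>E i\<in>UNIV. {1..k}) = shift_space k"
    by (auto simp: shift_space_def PiE_def Pi_def extensional_def)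
  have eq: "sets (bernoulli k p) = sigma_sets (shift_space k)
      {{x \<in> shift_space k. x i \<in> A} |i A. A \<subseteq> {1..k}}" (is "_ = sigma_sets _ ?G")
    unfolding bernoulli_def sets_PiM_single
    by (simp add: space_point_measure sets_point_measure PiE_eq[simplified])
  have single: "{x \<in> shift_space k. x i = a} \<in> ?G" if "a \<in> {1..k}" for i a
    using that by (auto intro!: exI[of _ i] exI[of _ "{a}"])
  show ?thesis unfolding eq
  proof (rule sigma_sets_eqI)
    fix B assume "B \<in> ?G"
    then obtain i A where B: "B = {x \<in> shift_space k. x i \<in> A}" and A: "A \<subseteq> {1..k}" by auto
    have "B = (\<Union>a\<in>A. cylinder k 0 (\<lambda>_. a) i)"
      by (auto simp: B cylinder_def)
    moreover have "cylinder k 0 (\<lambda>_. a) i \<in> sigma_sets (shift_space k) (cylinders k)" if "a \<in> A" for a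
      using that A unfolding cylinders_def
      by (intro sigma_sets.Basic CollectI exI[of _ 0] exI[of _ "\<lambda>_. a"] exI[of _ i]) auto
    moreover have "countable A" using A by simp
    ultimately show "B \<in> sigma_sets (shift_space k) (cylinders k)"
      by (auto intro!: sigma_sets_UNION)
  next
    fix B assume "B \<in> cylinders k"
    then obtain m y n where B: "B = cylinder k m y n" and y: "\<And>j. j \<le> m \<Longrightarrow> y j \<in> {1..k}"
      by (auto simp: cylinders_def)
    interpret sigma_algebra "shift_space k" "sigma_sets (shift_space k) ?G"
      by (rule sigma_algebra_sigma_sets) auto
    have "B = (\<Inter>j\<in>{..m}. {x \<in> shift_space k. x (n + int j) = y j})"
      by (auto simp: B cylinder_def)
    also have "\<dots> \<in> sigma_sets (shift_space k) ?G"
    proof (rule finite_INT)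
      fix j assume "j \<in> {..m}"
      then show "{x \<in> shift_space k. x (n + int j) = y j} \<in> sigma_sets (shift_space k) ?G"
        using y by (intro sigma_sets.Basic single) auto
    qed auto
    finally show "B \<in> sigma_sets (shift_space k) ?G" .
  qed
qed

lemma prob_space_letters:
  fixes k :: nat
  assumes "\<And>a. a \<in> {1..k} \<Longrightarrow> 0 \<le> p a" and "(\<Sum>a=1..k. p a) = 1"
  shows "prob_space (point_measure {1..k} (\<lambda>a. ennreal (p a)))"
proof
  have "emeasure (point_measure {1..k} (\<lambda>a. ennreal (p a))) {1..k} = (\<Sum>a=1..k. ennreal (p a))"
    by (rule emeasure_point_measure_finite) auto
  also have "\<dots> = ennreal (\<Sum>a=1..k. p a)"
    using assms(1) by (intro sum_ennreal) auto
  finally show "emeasure (point_measure {1..k} (\<lambda>a. ennreal (p a)))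
      (space (point_measure {1..k} (\<lambda>a. ennreal (p a)))) = 1"
    by (simp add: space_point_measure assms(2)[simplified])
qed

lemma prob_space_bernoulli:
  assumes "\<And>a. a \<in> {1..k} \<Longrightarrow> 0 \<le> p a" and "(\<Sum>a=1..k. p a) = 1"
  shows "prob_space (bernoulli k p)"
  unfolding bernoulli_def by (intro prob_space_PiM prob_space_letters assms)

lemma emeasure_bernoulli_cylinder:
  assumes p: "\<And>a. a \<in> {1..k} \<Longrightarrow> 0 \<le> p a" "(\<Sum>a=1..k. p a) = 1"
    and y: "\<And>j. j \<le> m \<Longrightarrow> y j \<in> {1..k}"
  shows "emeasure (bernoulli k p) (cylinder k m y n) = ennreal (\<Prod>j\<le>m. p (y j))"
proof -
  let ?L = "point_measure {1..k} (\<lambda>a. ennreal (p a))"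
  interpret L: prob_space ?L by (rule prob_space_letters[OF p])
  interpret product_prob_space "\<lambda>_::int. ?L" UNIV by unfold_locales
  let ?h = "\<lambda>j. n + int j"
  have inj: "inj_on ?h {..m}" by (auto intro: inj_onI)
  have "cylinder k m y n =
      {x \<in> space (bernoulli k p). \<forall>i\<in>?h ` {..m}. x i \<in> {y (nat (i - n))}}"
    by (auto simp: cylinder_def space_bernoulli)
  also have "emeasure (bernoulli k p) \<dots> = (\<Prod>i\<in>?h ` {..m}. emeasure ?L {y (nat (i - n))})"
    unfolding bernoulli_def
    using y by (intro emeasure_PiM_Collect) (auto simp: sets_point_measure)
  also have "\<dots> = (\<Prod>j\<le>m. emeasure ?L {y j})"
    by (subst prod.reindex[OF inj]) simp
  also have "\<dots> = (\<Prod>j\<le>m. ennreal (p (y j)))"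
    using y by (intro prod.cong) (auto simp: emeasure_point_measure_finite)
  also have "\<dots> = ennreal (\<Prod>j\<le>m. p (y j))"
    using p y by (intro prod_ennreal) auto
  finally show ?thesis .
qed

lemma mp_automorphism_bernoulli:
  assumes p: "\<And>a. a \<in> {1..k} \<Longrightarrow> 0 \<le> p a" "(\<Sum>a=1..k. p a) = 1"
  shows "mp_automorphism (bernoulli k p) shift_map"
proof -
  let ?L = "point_measure {1..k} (\<lambda>a. ennreal (p a))"
  interpret prob_space "bernoulli k p" by (rule prob_space_bernoulli[OF p])
  let ?U = "\<lambda>(x::int \<Rightarrow> nat) i. x (i - 1)"
  have bij: "bij_betw shift_map (shift_space k) (shift_space k)"
    by (rule bij_betw_byWitness[where f' = ?U]) (auto simp: shift_map_def shift_space_def)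
  have translate: "(\<lambda>x i. x (i + c)) \<in> measurable (bernoulli k p) (bernoulli k p)" for c :: int
    unfolding bernoulli_def
  proof (rule measurable_PiM_single')
    fix i :: int
    show "(\<lambda>x. x (i + c)) \<in> measurable (\<Pi>\<^sub>M i\<in>UNIV. ?L) ?L"
      by (rule measurable_component_singleton) simp
  qed (auto simp: space_PiM PiE_def Pi_def space_point_measure)
  have inv: "inv_into (shift_space k) shift_map x = ?U x" if "x \<in> shift_space k" for x
    using that by (intro inv_into_f_eq[OF bij_betw_imp_inj_on[OF bij]]) (auto simp: shift_map_def shift_space_def)
  show ?thesis
  proof
    show "bij_betw shift_map (space (bernoulli k p)) (space (bernoulli k p))"
      using bij by (simp add: space_bernoulli)
    show "shift_map \<in> measurable (bernoulli k p) (bernoulli k p)"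
      using translate[of 1] by (simp add: shift_map_def[abs_def])
    show "inv_into (space (bernoulli k p)) shift_map \<in> measurable (bernoulli k p) (bernoulli k p)"
      using translate[of "-1"] inv by (subst measurable_cong[where g = ?U]) (auto simp: space_bernoulli)
    show "distr (bernoulli k p) (bernoulli k p) shift_map = bernoulli k p"
      using distr_PiM_reindex[of UNIV "\<lambda>_. ?L" "\<lambda>i::int. i + 1" UNIV] prob_space_letters[OF p]
      by (simp add: bernoulli_def shift_map_def[abs_def] restrict_def)
  qed
qed

end

theory Submission
  imports Defs
begin

text \<open>
  Partition the space into the cylinders \<open>A\<^sub>w\<close> of a large length and approximate their indicators.
  A translate \<open>g\<^sub>m \<circ> T\<^sup>t\<close> that carries most of its weight in the approximation of some \<open>A\<^sub>w\<close>
  lives mostly on \<open>A\<^sub>w\<close>, so the time \<open>t\<close> fixes the letter at \<open>-t\<close> of most points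
  seen by \<open>g\<^sub>m\<close>. If there are \<open>l\<close> such times, then \<open>g\<^sub>m\<close> is concentrated on a Hamming ball of
  measure at most \<open>\<rho>\<^sup>l\<close> with \<open>\<rho> < 1\<close>, and its translates cover only measure \<open>l \<rho>\<^sup>l\<close>.
  Hence the \<open>g\<^sub>m\<close> with \<open>l \<ge> C\<close> cover little. Each remaining \<open>g\<^sub>m\<close> serves fewer than \<open>C\<close>
  cylinders, because a time is good for at most one cylinder; these have small total measure when
  the cylinders are long. So most of the space is not covered at all.
\<close>

section \<open>Integer translations, Hamming balls and localized approximations\<close>

text \<open>A closed form of the iterates of \<open>shift_map\<close> for all integer times, free of
  \<open>inv_into\<close>; \<open>int_iter_shift_map\<close> identifies the two on
  \<open>space M\<close>.\<close>

definition translate :: "int \<Rightarrow> (int \<Rightarrow> nat) \<Rightarrow> int \<Rightarrow> nat" where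
  "translate t x = (\<lambda>i. x (i + t))"

lemma translate_translate [simp]: "translate s (translate t x) = translate (s + t) x"
  by (simp add: translate_def algebra_simps)

lemma translate_0 [simp]: "translate 0 x = x"
  by (simp add: translate_def)

lemma translate_apply [simp]: "translate t x i = x (i + t)"
  by (simp add: translate_def)

text \<open>The radius is a proportion of \<open>card J\<close>, not an absolute count, so that the
  measure of a ball is bounded by a power with exponent \<open>card J\<close>.\<close>

definition hamming_ball :: "nat \<Rightarrow> int set \<Rightarrow> (int \<Rightarrow> nat) \<Rightarrow> real \<Rightarrow> (int \<Rightarrow> nat) set" where
  "hamming_ball k J c s =
    {x \<in> shift_space k. (\<Sum>j\<in>J. of_bool (x j \<noteq> c j)) \<le> s * real (card J)}"

text \<open>Multiplying by the indicator of \<open>E\<close> cannot increase an L1 distance, and the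
  integral of a difference is bounded by its L1 norm. An approximation of an indicator can thus be
  tested on any event.\<close>

lemma abs_measure_diff_sum_le:
  assumes "finite_measure M" "finite P" and A: "A \<in> sets M" and E: "E \<in> sets M"
    and F: "\<And>q. q \<in> P \<Longrightarrow> integrable M (F q)"
  shows "\<bar>measure M (A \<inter> E) - (\<Sum>q\<in>P. a q * (\<integral>x. indicator E x * F q x \<partial>M))\<bar>
    \<le> (\<integral>x. \<bar>indicator A x - (\<Sum>q\<in>P. a q * F q x)\<bar> \<partial>M)"
proof -
  interpret finite_measure M by fact
  have FE: "integrable M (\<lambda>x. indicator E x * F q x)" if "q \<in> P" for q
    using integrable_mult_indicator[OF E F[OF that]] by simp
  have AE: "integrable M (indicator (A \<inter> E) :: _ \<Rightarrow> real)"
    using A E by (intro integrable_real_indicator) (auto simp: less_top[symmetric])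
  have A': "integrable M (indicator A :: _ \<Rightarrow> real)"
    using A by (intro integrable_real_indicator) (auto simp: less_top[symmetric])
  have "measure M (A \<inter> E) - (\<Sum>q\<in>P. a q * (\<integral>x. indicator E x * F q x \<partial>M))
      = (\<integral>x. indicator (A \<inter> E) x \<partial>M) - (\<integral>x. (\<Sum>q\<in>P. a q * (indicator E x * F q x)) \<partial>M)"
    using A E FE by (subst Bochner_Integration.integral_sum) (auto simp: Int_absorb2 sets.sets_into_space)
  also have "\<dots> = (\<integral>x. indicator (A \<inter> E) x - (\<Sum>q\<in>P. a q * (indicator E x * F q x)) \<partial>M)"
    using AE FE by (subst Bochner_Integration.integral_diff) auto
  also have "\<bar>\<dots>\<bar> \<le> (\<integral>x. \<bar>indicator (A \<inter> E) x - (\<Sum>q\<in>P. a q * (indicator E x * F q x))\<bar> \<partial>M)"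
    by (rule integral_abs_bound)
  also have "\<dots> \<le> (\<integral>x. \<bar>indicator A x - (\<Sum>q\<in>P. a q * F q x)\<bar> \<partial>M)"
    using AE FE A' F by (intro integral_mono) (auto split: split_indicator)
  finally show ?thesis .
qed

section \<open>Integration on the Bernoulli shift: invariance and independence\<close>

text \<open>\<open>q\<close> stands for a common bound on the letter probabilities; that it lies
  below 1 enters only through the choice of parameters in
  \<open>exists_ball_parameters\<close>.\<close>

locale bernoulli_shift =
  fixes k :: nat and p :: "nat \<Rightarrow> real" and q :: real
  assumes p_nonneg: "a \<in> {1..k} \<Longrightarrow> 0 \<le> p a"
    and p_sum: "(\<Sum>a=1..k. p a) = 1"
    and p_le: "a \<in> {1..k} \<Longrightarrow> p a \<le> q"
    and q_nonneg: "0 \<le> q"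
begin

abbreviation "L \<equiv> point_measure {1..k} (\<lambda>a. ennreal (p a))"
abbreviation "M \<equiv> bernoulli k p"

sublocale L: prob_space L
  by (rule prob_space_letters[OF p_nonneg p_sum])

sublocale P: product_prob_space "\<lambda>_::int. L" UNIV
  by unfold_locales

sublocale prob_space M
  by (rule prob_space_bernoulli[OF p_nonneg p_sum])

lemma measurable_coordinate [measurable]: "(\<lambda>x. x i) \<in> measurable M (count_space UNIV)"
proof -
  have "(\<lambda>x. x i) \<in> measurable M L"
    unfolding bernoulli_def by (rule measurable_component_singleton) simp
  moreover have "(\<lambda>a. a) \<in> measurable L (count_space UNIV)"
    by (auto simp: measurable_def space_point_measure sets_point_measure)
  ultimately show ?thesis
    using measurable_compose by blast
qed

lemma measurable_translate [measurable]: "translate t \<in> measurable M M"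
  unfolding bernoulli_def
proof (rule measurable_PiM_single')
  fix i :: int
  show "(\<lambda>x. translate t x i) \<in> measurable (\<Pi>\<^sub>M i\<in>UNIV. L) L"
    unfolding translate_apply by (rule measurable_component_singleton) simp
qed (auto simp: space_PiM PiE_def Pi_def space_point_measure)

lemma distr_translate: "distr M M (translate t) = M"
  using distr_PiM_reindex[of UNIV "\<lambda>_. L" "\<lambda>i::int. i + t" UNIV] prob_space_letters[OF p_nonneg p_sum]
  by (simp add: bernoulli_def translate_def[abs_def] restrict_def)

lemma integral_translate:
  assumes "f \<in> borel_measurable M"
  shows "(\<integral>x. f (translate t x) \<partial>M) = (\<integral>x. (f x :: real) \<partial>M)"
  using integral_distr[OF measurable_translate assms, of t] by (simp add: distr_translate)

lemma integrable_translate: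
  assumes "integrable M (f :: _ \<Rightarrow> real)"
  shows "integrable M (\<lambda>x. f (translate t x))"
  using integrable_distr[OF measurable_translate[of t], where f = f] assms by (simp add: distr_translate)

lemma AE_translate:
  assumes "AE x in M. Q x"
  shows "AE x in M. Q (translate t x)"
  by (rule AE_distrD[OF measurable_translate]) (unfold distr_translate, rule assms)

text \<open>Stated on \<open>space M\<close> because \<open>inv_into\<close> is determined only on
  the image of the space.\<close>

lemma int_iter_shift_map:
  assumes "x \<in> space M"
  shows "int_iter M shift_map t x = translate t x"
proof -
  have bij: "bij_betw shift_map (space M) (space M)"
    using mp_automorphism_bernoulli[OF p_nonneg p_sum] by (simp add: mp_automorphism_def mp_automorphism_axioms_def)
  have T: "translate s y \<in> space M" if "y \<in> space M" for s y
    using measurable_space[OF measurable_translate that] .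
  have inv: "inv_into (space M) shift_map y = translate (- 1) y" if "y \<in> space M" for y
    using T[OF that, of "-1"] 
    by (intro inv_into_f_eq[OF bij_betw_imp_inj_on[OF bij]]) (auto simp: shift_map_def)
  have pos: "(shift_map ^^ l) x = translate (int l) x" for l
    by (induction l) (auto simp: shift_map_def algebra_simps)
  have neg: "(inv_into (space M) shift_map ^^ l) x = translate (- int l) x" for l
  proof (induction l)
    case (Suc l)
    then show ?case
      using inv[OF T[OF assms]] by (simp add: minus_diff_commute del: translate_apply)
  qed simp
  show ?thesis
    by (simp add: int_iter_def pos neg)
qed

text \<open>Independence of the coordinates: the integrand sees only those in \<open>J\<close>, so
  the integral passes to the finite marginal, a product measure, where it factors.\<close>

lemma integral_prod_coordinates:
  assumes J: "finite J"
  shows "(\<integral>x. (\<Prod>j\<in>J. f j (x j)) \<partial>M) = (\<Prod>j\<in>J. \<Sum>a=1..k. p a * (f j a :: real))"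
proof -
  have meas: "(\<lambda>x. \<Prod>j\<in>J. f j (x j)) \<in> borel_measurable (Pi\<^sub>M J (\<lambda>_. L))"
  proof (rule borel_measurable_prod)
    fix j assume "j \<in> J"
    then have "(\<lambda>x. x j) \<in> measurable (Pi\<^sub>M J (\<lambda>_. L)) L"
      by (rule measurable_component_singleton)
    moreover have "f j \<in> borel_measurable L"
      by (auto simp: measurable_def space_point_measure sets_point_measure)
    ultimately show "(\<lambda>x. f j (x j)) \<in> borel_measurable (Pi\<^sub>M J (\<lambda>_. L))"
      by (rule measurable_compose)
  qed
  \<comment> \<open>Inserting \<open>restrict x J\<close> displays the integrand as a function of
    the marginal.\<close>
  have "(\<integral>x. (\<Prod>j\<in>J. f j (x j)) \<partial>M) = (\<integral>x. (\<Prod>j\<in>J. f j (restrict x J j)) \<partial>M)"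
    by (intro Bochner_Integration.integral_cong refl prod.cong) auto
  also have "\<dots> = (\<integral>x. (\<Prod>j\<in>J. f j (x j)) \<partial>distr M (Pi\<^sub>M J (\<lambda>_. L)) (\<lambda>x. restrict x J))"
    unfolding bernoulli_def
    by (rule integral_distr[OF measurable_restrict_subset meas, symmetric]) simp
  also have "\<dots> = (\<integral>x. (\<Prod>j\<in>J. f j (x j)) \<partial>Pi\<^sub>M J (\<lambda>_. L))"
    unfolding bernoulli_def by (subst P.distr_PiM_restrict_finite[OF J]) auto
  also have "\<dots> = (\<Prod>j\<in>J. integral\<^sup>L L (f j))"
    using J by (intro P.product_integral_prod) (auto intro!: integrable_point_measure_finite)
  also have "\<dots> = (\<Prod>j\<in>J. \<Sum>a=1..k. p a * f j a)"
    using p_nonneg by (intro prod.cong refl, subst lebesgue_integral_point_measure_finite) auto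
  finally show ?thesis .
qed

section \<open>Hamming balls: small measure and concentration of mass\<close>

lemma sets_hamming_ball [measurable]: "hamming_ball k J c s \<in> sets M"
  unfolding hamming_ball_def space_bernoulli[symmetric, of k p] by measurable

text \<open>The exponential Markov inequality for the number of mismatches.\<close>

lemma measure_hamming_ball_le:
  assumes J: "finite J" and \<theta>: "0 < \<theta>" "\<theta> \<le> 1"
  shows "measure M (hamming_ball k J c s) \<le> ((q + \<theta>) / \<theta> powr s) ^ card J"
proof -
  let ?B = "hamming_ball k J c s"
  \<comment> \<open>Each mismatch costs a factor \<theta>, so \<open>?G x\<close> is \<theta> to the
    number of mismatches of \<open>x\<close> with \<open>c\<close> on \<open>J\<close>. On the ball
    this is at least \<theta> to the power \<open>s * card J\<close>, because \<theta> \<le>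
    1.\<close>
  let ?f = "\<lambda>j a. if a = c j then 1 else \<theta>"
  let ?G = "\<lambda>x. \<Prod>j\<in>J. ?f j (x j)"
  have "(\<theta> powr s) ^ card J * indicator ?B x \<le> ?G x" for x
  proof (cases "x \<in> ?B")
    case True
    let ?D = "\<Sum>j\<in>J. of_bool (x j \<noteq> c j) :: real"
    have "(\<theta> powr s) ^ card J = \<theta> powr (s * real (card J))"
      using \<theta> by (simp add: powr_powr flip: powr_realpow)
    also have "\<dots> \<le> \<theta> powr ?D"
      using \<theta> True by (intro powr_mono') (auto simp: hamming_ball_def)
    also have "\<dots> = (\<Prod>j\<in>J. \<theta> powr of_bool (x j \<noteq> c j))"
      using \<theta> J by (intro powr_sum) auto
    also have "\<dots> = ?G x"
      using \<theta> by (intro prod.cong) auto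
    finally show ?thesis using True by simp
  qed (use \<theta> in \<open>auto intro!: prod_nonneg\<close>)
  moreover have "\<bar>?G x\<bar> \<le> 1" for x
    using \<theta> by (auto simp: abs_prod intro!: prod_le_1)
  then have "integrable M ?G"
    by (intro integrable_const_bound[where B = 1]) auto
  ultimately have "(\<theta> powr s) ^ card J * measure M ?B \<le> (\<integral>x. ?G x \<partial>M)"
    using integral_mono[of M "\<lambda>x. (\<theta> powr s) ^ card J * indicator ?B x" ?G]
    by (simp add: emeasure_eq_measure)
  also have "\<dots> = (\<Prod>j\<in>J. \<Sum>a=1..k. p a * ?f j a)"
    by (rule integral_prod_coordinates[OF J])
  also have "\<dots> \<le> (\<Prod>j\<in>J. q + \<theta>)"
  proof (intro prod_mono conjI)
    fix j assume "j \<in> J"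
    \<comment> \<open>The matching letter contributes at most \<open>q\<close>, or 0 if
      \<open>c j\<close> is not a letter; a weight \<theta> on all letters adds up to
      \<theta>.\<close>
    have "(\<Sum>a=1..k. p a * ?f j a) \<le> (\<Sum>a=1..k. (if a = c j then p a else 0) + p a * \<theta>)"
      using p_nonneg \<theta> by (intro sum_mono) auto
    also have "\<dots> = (if c j \<in> {1..k} then p (c j) else 0) + \<theta>"
      using p_sum by (simp add: sum.distrib flip: sum_distrib_right)
    also have "\<dots> \<le> q + \<theta>"
      using p_le q_nonneg by auto
    finally show "(\<Sum>a=1..k. p a * ?f j a) \<le> q + \<theta>" .
    show "0 \<le> (\<Sum>a=1..k. p a * ?f j a)"
      using p_nonneg \<theta> by (intro sum_nonneg) auto
  qed
  finally show ?thesis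
    using \<theta> by (simp add: power_divide field_simps)
qed

text \<open>Markov's inequality for the number of mismatches under the measure with density
  \<open>g\<close>: summing \<open>close\<close> over \<open>J\<close> bounds the weighted count,
  which exceeds \<open>s * card J\<close> off the ball.\<close>

lemma integral_outside_hamming_ball_le:
  assumes J: "finite J" and g: "integrable M g" "\<And>x. 0 \<le> g x" and s: "0 < s"
    and close: "\<And>j. j \<in> J \<Longrightarrow> (\<integral>x. of_bool (x j \<noteq> c j) * g x \<partial>M) \<le> \<delta> * (\<integral>x. g x \<partial>M)"
  shows "J \<noteq> {} \<Longrightarrow>
    (\<integral>x. indicator (space M - hamming_ball k J c s) x * g x \<partial>M) \<le> \<delta> / s * (\<integral>x. g x \<partial>M)"
proof -
  assume "J \<noteq> {}"
  then have pos: "0 < s * real (card J)"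
    using J s by (auto simp: card_gt_0_iff)
  let ?I = "\<integral>x. g x \<partial>M"
  let ?B = "space M - hamming_ball k J c s"
  have int: "integrable M (\<lambda>x. of_bool (x j \<noteq> c j) * g x)" for j
    by (rule Bochner_Integration.integrable_bound[OF g(1)]) (use g in auto)
  have intB: "integrable M (\<lambda>x. indicator ?B x * g x)"
    by (rule Bochner_Integration.integrable_bound[OF g(1)]) (use g in \<open>auto split: split_indicator\<close>)
  have "s * real (card J) * (\<integral>x. indicator ?B x * g x \<partial>M)
      = (\<integral>x. s * real (card J) * (indicator ?B x * g x) \<partial>M)"
    by simp
  also have "\<dots> \<le> (\<integral>x. (\<Sum>j\<in>J. of_bool (x j \<noteq> c j) * g x) \<partial>M)"
  proof (rule integral_mono)
    fix x assume "x \<in> space M"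
    then show "s * real (card J) * (indicator ?B x * g x) \<le> (\<Sum>j\<in>J. of_bool (x j \<noteq> c j) * g x)"
      using g(2)[of x]
      by (auto simp: hamming_ball_def space_bernoulli sum_nonneg simp flip: sum_distrib_right
          split: split_indicator intro!: mult_right_mono)
  qed (use int intB in auto)
  also have "\<dots> = (\<Sum>j\<in>J. \<integral>x. of_bool (x j \<noteq> c j) * g x \<partial>M)"
    using int by (rule Bochner_Integration.integral_sum)
  also have "\<dots> \<le> (\<Sum>j\<in>J. \<delta> * ?I)"
    by (intro sum_mono close)
  finally have "real (card J) * (s * (\<integral>x. indicator ?B x * g x \<partial>M)) \<le> real (card J) * (\<delta> * ?I)"
    by (simp add: mult_ac)
  then have "s * (\<integral>x. indicator ?B x * g x \<partial>M) \<le> \<delta> * ?I"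
    using pos s by (simp add: zero_less_mult_iff)
  then show ?thesis
    using s by (simp add: field_simps)
qed

text \<open>
  A function whose translates by the times in \<open>\<Lambda>\<close> nearly determine the letter at \<open>0\<close> lives mostly
  on a Hamming ball with \<^term>\<open>card \<Lambda>\<close> constraints, so the exponentially small measure of the ball
  beats the number of its translates.
\<close>

lemma exists_small_carrier:
  assumes \<Lambda>: "finite \<Lambda>" and g: "integrable M g" "\<And>x. 0 \<le> g x" and s: "0 < s"
    and \<theta>: "0 < \<theta>" "\<theta> \<le> 1"
    and close: "\<And>t. t \<in> \<Lambda> \<Longrightarrow>
      (\<integral>x. of_bool (x 0 \<noteq> c t) * g (translate t x) \<partial>M) \<le> \<delta> * (\<integral>x. g x \<partial>M)"
  obtains U where "U \<in> sets M"
    "measure M U \<le> real (card \<Lambda>) * ((q + \<theta>) / \<theta> powr s) ^ card \<Lambda>"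
    "\<And>t. t \<in> \<Lambda> \<Longrightarrow>
      (\<integral>x. indicator (space M - U) x * g (translate t x) \<partial>M) \<le> \<delta> / s * (\<integral>x. g x \<partial>M)"
proof
  have [measurable]: "g \<in> borel_measurable M" using g by auto
  \<comment> \<open>The sign changes because \<open>translate (- t) x\<close> has the letter
    \<open>x (- t)\<close> at 0: knowing the letter at 0 for the translate of \<open>g\<close> by
    \<open>t\<close> constrains \<open>g\<close> itself at coordinate \<open>- t\<close>.\<close>
  let ?J = "uminus ` \<Lambda>"
  let ?c = "\<lambda>j. c (- j)"
  let ?B = "hamming_ball k ?J ?c s"
  \<comment> \<open>Taking the union over all times gives one carrier for all translates; by
    invariance it costs only the factor \<open>card \<Lambda>\<close>.\<close>
  let ?U = "\<Union>t\<in>\<Lambda>. translate t -` ?B \<inter> space M"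
  have cJ: "card ?J = card \<Lambda>" by (simp add: card_image)
  have meas: "translate t -` ?B \<inter> space M \<in> sets M" for t
    by (rule measurable_sets[OF measurable_translate]) measurable
  show U [measurable]: "?U \<in> sets M"
    using \<Lambda> meas by auto
  have "measure M ?U \<le> (\<Sum>t\<in>\<Lambda>. measure M (translate t -` ?B \<inter> space M))"
    using \<Lambda> meas by (intro finite_measure_subadditive_finite) auto
  also have "\<dots> = (\<Sum>t\<in>\<Lambda>. measure M ?B)"
    by (intro sum.cong refl, subst measure_distr[OF measurable_translate, symmetric])
      (auto simp: distr_translate)
  also have "\<dots> \<le> (\<Sum>t\<in>\<Lambda>. ((q + \<theta>) / \<theta> powr s) ^ card ?J)"
    using \<Lambda> \<theta> by (intro sum_mono measure_hamming_ball_le) auto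
  finally show "measure M ?U \<le> real (card \<Lambda>) * ((q + \<theta>) / \<theta> powr s) ^ card \<Lambda>"
    by (simp add: cJ)
  fix t assume t: "t \<in> \<Lambda>"
  have T: "translate t x \<in> space M" if "x \<in> space M" for t x
    using measurable_space[OF measurable_translate that] .
  have intB: "integrable M (\<lambda>x. indicator (space M - ?B) x * g x)"
    by (rule Bochner_Integration.integrable_bound[OF g(1)]) (use g in \<open>auto split: split_indicator\<close>)
  have intU: "integrable M (\<lambda>x. indicator (space M - ?U) x * g (translate t x))"
    by (rule Bochner_Integration.integrable_bound[OF integrable_translate[OF g(1), of t]])
      (use g in \<open>auto split: split_indicator\<close>)
  have "(\<integral>x. indicator (space M - ?U) x * g (translate t x) \<partial>M)
      \<le> (\<integral>x. indicator (space M - ?B) (translate t x) * g (translate t x) \<partial>M)"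
    using integrable_translate[OF intB, of t] intU t g T
    by (intro integral_mono) (auto split: split_indicator)
  also have "\<dots> = (\<integral>x. indicator (space M - ?B) x * g x \<partial>M)"
    by (rule integral_translate) measurable
  also have "\<dots> \<le> \<delta> / s * (\<integral>x. g x \<partial>M)"
  proof (rule integral_outside_hamming_ball_le[OF _ g s])
    fix j assume "j \<in> ?J"
    then have j: "- j \<in> \<Lambda>" by auto
    \<comment> \<open>Translating by \<open>- j\<close> moves coordinate \<open>j\<close> to 0,
      which is hypothesis \<open>close\<close> at the time \<open>- j\<close>.\<close>
    have "(\<integral>x. of_bool (x j \<noteq> c (- j)) * g x \<partial>M)
        = (\<integral>x. of_bool (translate (- j) x j \<noteq> c (- j)) * g (translate (- j) x) \<partial>M)"
      by (rule integral_translate[symmetric]) measurable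
    also have "\<dots> \<le> \<delta> * (\<integral>x. g x \<partial>M)"
      using close[OF j] by simp
    finally show "(\<integral>x. of_bool (x j \<noteq> c (- j)) * g x \<partial>M) \<le> \<delta> * (\<integral>x. g x \<partial>M)" .
  qed (use \<Lambda> t in auto)
  finally show "(\<integral>x. indicator (space M - ?U) x * g (translate t x) \<partial>M) \<le> \<delta> / s * (\<integral>x. g x \<partial>M)" .
qed

section \<open>The covering estimate\<close>

text \<open>The quantitative form of the contradiction: when \<open>a\<close>, \<eta> and \<epsilon>
  are small, the left side is near 1 and the right side near 1/4. The index set \<open>Q\<close>
  flattens the double sum of the approximation, \<nu> and \<tau> giving the function and the time of
  each term.\<close>

lemma approximation_bound:
  fixes A :: "'i \<Rightarrow> (int \<Rightarrow> nat) set" and g :: "'m \<Rightarrow> (int \<Rightarrow> nat) \<Rightarrow> real"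
    and \<nu> :: "'j \<Rightarrow> 'm" and \<tau> :: "'j \<Rightarrow> int" and C :: nat
  assumes R: "finite R" and Q: "finite Q" and H: "finite H" and \<nu>: "\<And>j. j \<in> Q \<Longrightarrow> \<nu> j \<in> H"
    and A: "\<And>i. i \<in> R \<Longrightarrow> A i \<in> sets M" "disjoint_family_on A R" "(\<Union>i\<in>R. A i) = space M"
    and A_small: "\<And>i. i \<in> R \<Longrightarrow> measure M (A i) \<le> a"
    and A_letter: "\<And>i x. i \<in> R \<Longrightarrow> x \<in> A i \<Longrightarrow> x 0 = c i"
    and g: "\<And>m. m \<in> H \<Longrightarrow> integrable M (g m)" "\<And>m x. m \<in> H \<Longrightarrow> 0 \<le> g m x"
    and \<alpha>: "\<And>i j. i \<in> R \<Longrightarrow> j \<in> Q \<Longrightarrow> 0 \<le> \<alpha> i j"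
    and approx: "\<And>i. i \<in> R \<Longrightarrow>
      (\<integral>x. \<bar>indicator (A i) x - (\<Sum>j\<in>Q. \<alpha> i j * g (\<nu> j) (translate (\<tau> j) x))\<bar> \<partial>M) \<le> \<epsilon>"
    and \<theta>: "0 < \<theta>" "\<theta> \<le> 1" and \<delta>: "0 < \<delta>" "\<delta> \<le> 1 / 2" and \<epsilon>: "0 \<le> \<epsilon>" and a: "0 \<le> a" and \<eta>: "0 \<le> \<eta>"
    and C: "\<And>l. C \<le> l \<Longrightarrow> real l * ((q + \<theta>) / \<theta> powr (4 * \<delta>)) ^ l \<le> \<eta>"
  shows "1 - real (card H) * real C * a - real (card H) * \<eta> \<le> real (card R) * (2 * \<epsilon> + \<epsilon> / \<delta>) + 1 / 4"
proof -
  define I where "I m = (\<integral>x. g m x \<partial>M)" for m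
  define b where "b m i t = (\<integral>x. indicator (space M - A i) x * g m (translate t x) \<partial>M)" for m i t
  \<comment> \<open>A good time leaves less than the proportion \<delta> of the mass outside
    \<open>A i\<close>. By strictness a function with zero integral has no good time.\<close>
  define good where "good m i t \<longleftrightarrow> b m i t < \<delta> * I m" for m i t
  define \<Lambda> where "\<Lambda> m = {t \<in> \<tau> ` Q. \<exists>i\<in>R. good m i t}" for m
  define \<iota> where "\<iota> m t = (SOME i. i \<in> R \<and> good m i t)" for m t
  \<comment> \<open>The cylinders served by functions with fewer than \<open>C\<close> good
    times.\<close>
  define W where "W = (\<Union>m\<in>{m\<in>H. card (\<Lambda> m) < C}. \<iota> m ` \<Lambda> m)"

  have [measurable]: "A i \<in> sets M" if "i \<in> R" for i using A(1) that .
  have fin\<Lambda>: "finite (\<Lambda> m)" for m using Q by (simp add: \<Lambda>_def)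
  have int_g: "integrable M (\<lambda>x. g m (translate t x))" if "m \<in> H" for m t
    by (rule integrable_translate[OF g(1)[OF that]])
  have int_ind: "integrable M (\<lambda>x. indicator E x * g m (translate t x))"
    if "m \<in> H" "E \<in> sets M" for m t E
    using integrable_mult_indicator[OF that(2) int_g[OF that(1)]] by simp
  have I_translate: "(\<integral>x. g m (translate t x) \<partial>M) = I m" if "m \<in> H" for m t
    unfolding I_def using g(1)[OF that] by (intro integral_translate) auto
  have I_nonneg: "0 \<le> I m" if "m \<in> H" for m
    using g(2)[OF that] by (simp add: I_def)
  have b_nonneg: "0 \<le> b m i t" if "m \<in> H" for m i t
    using g(2)[OF that] by (simp add: b_def)
  have ind_le: "(\<integral>x. indicator E x * g m (translate t x) \<partial>M) \<le> I m"
    if "m \<in> H" "E \<in> sets M" for m t E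
    unfolding I_translate[OF that(1), of t, symmetric]
    using int_ind[OF that] int_g[OF that(1)] g(2)[OF that(1)]
    by (intro integral_mono) (auto split: split_indicator)

  \<comment> \<open>The complements of two disjoint cylinders cover the space, so two good ones
    would force the whole mass \<open>I m\<close> below \<open>2 * \<delta> * I m\<close>, hence
    below itself.\<close>
  have good_unique: "i = i'" if m: "m \<in> H" and i: "i \<in> R" "i' \<in> R" and good: "good m i t" "good m i' t" for m i i' t
  proof (rule ccontr)
    assume "i \<noteq> i'"
    then have "A i \<inter> A i' = {}" using A(2) i by (auto simp: disjoint_family_on_def)
    then have "I m \<le> (\<integral>x. indicator (space M - A i) x * g m (translate t x)
        + indicator (space M - A i') x * g m (translate t x) \<partial>M)"
      unfolding I_translate[OF m, of t, symmetric]
      using int_g[OF m] int_ind[OF m] g(2)[OF m] i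
      by (intro integral_mono) (auto split: split_indicator)
    also have "\<dots> = b m i t + b m i' t"
      unfolding b_def using int_ind[OF m] i by (intro Bochner_Integration.integral_add) auto
    also have "\<dots> < 2 * \<delta> * I m" using good by (simp add: good_def)
    also have "\<dots> \<le> 1 * I m" using \<delta> I_nonneg[OF m] by (intro mult_right_mono) auto
    finally show False by simp
  qed
  have \<iota>: "\<iota> m t \<in> R \<and> good m (\<iota> m t) t" if "t \<in> \<Lambda> m" for m t
  proof -
    have "\<exists>i. i \<in> R \<and> good m i t" using that by (auto simp: \<Lambda>_def)
    then show ?thesis unfolding \<iota>_def by (rule someI_ex)
  qed

  have "\<exists>U. U \<in> sets M \<and>
      measure M U \<le> real (card (\<Lambda> m)) * ((q + \<theta>) / \<theta> powr (4 * \<delta>)) ^ card (\<Lambda> m) \<and>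
      (\<forall>t\<in>\<Lambda> m. (\<integral>x. indicator (space M - U) x * g m (translate t x) \<partial>M) \<le> 1 / 4 * I m)"
    (is "\<exists>U. ?P m U") if m: "m \<in> H" for m
  \<comment> \<open>The choice \<open>s = 4 * \<delta>\<close> turns the mass
    \<open>\<delta> / s\<close> off the carrier into 1/4. The prescribed letter at time
    \<open>t\<close> is the common letter at 0 of the cylinder
    \<open>A (\<iota> m t)\<close>.\<close>
  proof (rule exists_small_carrier[OF fin\<Lambda> g(1)[OF m] g(2)[OF m] _ \<theta>, where s = "4 * \<delta>" and \<delta> = \<delta>])
    fix t assume t: "t \<in> \<Lambda> m"
    let ?c = "\<lambda>t. c (\<iota> m t)"
    have [measurable]: "g m \<in> borel_measurable M" using g(1)[OF m] by auto
    have "(\<integral>x. of_bool (x 0 \<noteq> ?c t) * g m (translate t x) \<partial>M) \<le> b m (\<iota> m t) t"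
      unfolding b_def
    proof (rule integral_mono)
      show "integrable M (\<lambda>x. of_bool (x 0 \<noteq> ?c t) * g m (translate t x))"
        by (rule Bochner_Integration.integrable_bound[OF int_g[OF m, of t]]) (use g(2)[OF m] in auto)
      show "integrable M (\<lambda>x. indicator (space M - A (\<iota> m t)) x * g m (translate t x))"
        using \<iota>[OF t] by (intro int_ind[OF m]) auto
      show "of_bool (x 0 \<noteq> ?c t) * g m (translate t x)
          \<le> indicator (space M - A (\<iota> m t)) x * g m (translate t x)" if "x \<in> space M" for x
        using A_letter[of "\<iota> m t" x] \<iota>[OF t] that g(2)[OF m] by (auto split: split_indicator)
    qed
    also have "\<dots> \<le> \<delta> * (\<integral>x. g m x \<partial>M)"
      using \<iota>[OF t] by (simp add: good_def I_def)
    finally show "(\<integral>x. of_bool (x 0 \<noteq> ?c t) * g m (translate t x) \<partial>M) \<le> \<delta> * (\<integral>x. g m x \<partial>M)" .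
  next
    fix U
    assume "U \<in> sets M"
      "measure M U \<le> real (card (\<Lambda> m)) * ((q + \<theta>) / \<theta> powr (4 * \<delta>)) ^ card (\<Lambda> m)"
      "\<And>t. t \<in> \<Lambda> m \<Longrightarrow> (\<integral>x. indicator (space M - U) x * g m (translate t x) \<partial>M)
         \<le> \<delta> / (4 * \<delta>) * (\<integral>x. g m x \<partial>M)"
    then show ?thesis using \<delta> by (intro exI[of _ U]) (auto simp: I_def)
  qed (use \<delta> in auto)
  then have "\<forall>m\<in>H. \<exists>U. ?P m U" by blast
  from bchoice[OF this] obtain U where "\<forall>m\<in>H. ?P m (U m)" ..
  then have U: "\<And>m. m \<in> H \<Longrightarrow> U m \<in> sets M"
      "\<And>m. m \<in> H \<Longrightarrow> measure M (U m) \<le> real (card (\<Lambda> m)) * ((q + \<theta>) / \<theta> powr (4 * \<delta>)) ^ card (\<Lambda> m)"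
      "\<And>m t. m \<in> H \<Longrightarrow> t \<in> \<Lambda> m \<Longrightarrow>
        (\<integral>x. indicator (space M - U m) x * g m (translate t x) \<partial>M) \<le> 1 / 4 * I m"
    by blast+
  \<comment> \<open>Every carrier collected here has at least \<open>C\<close> times, so hypothesis
    \<open>C\<close> bounds its measure by \<eta>.\<close>
  define V where "V = (\<Union>m\<in>{m\<in>H. C \<le> card (\<Lambda> m)}. U m)"
  have V [measurable]: "V \<in> sets M" using H U(1) by (auto simp: V_def)
  have "measure M V \<le> (\<Sum>m\<in>{m\<in>H. C \<le> card (\<Lambda> m)}. measure M (U m))"
    unfolding V_def using H U(1) by (intro finite_measure_subadditive_finite) auto
  also have "\<dots> \<le> (\<Sum>m\<in>{m\<in>H. C \<le> card (\<Lambda> m)}. \<eta>)"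
    using U(2) C by (intro sum_mono) (auto intro: order_trans)
  also have "\<dots> \<le> real (card H) * \<eta>"
    using H \<eta> by (auto intro!: mult_right_mono card_mono)
  finally have V_le: "measure M V \<le> real (card H) * \<eta>" .

  have "card W \<le> (\<Sum>m\<in>{m\<in>H. card (\<Lambda> m) < C}. card (\<iota> m ` \<Lambda> m))"
    unfolding W_def using H by (intro card_UN_le) auto
  also have "\<dots> \<le> (\<Sum>m\<in>{m\<in>H. card (\<Lambda> m) < C}. C)"
    using fin\<Lambda> by (intro sum_mono) (auto intro: order_trans[OF card_image_le] less_imp_le)
  also have "\<dots> \<le> card H * C"
    using H by (auto intro!: card_mono)
  finally have cardW: "card W \<le> card H * C" .
  have WR: "W \<subseteq> R" using \<iota> by (auto simp: W_def)

  have est: "\<bar>measure M (A i \<inter> E) - (\<Sum>j\<in>Q. \<alpha> i j * (\<integral>x. indicator E x * g (\<nu> j) (translate (\<tau> j) x) \<partial>M))\<bar> \<le> \<epsilon>"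
    if "i \<in> R" "E \<in> sets M" for i E
    using abs_measure_diff_sum_le[OF finite_measure_axioms Q A(1)[OF that(1)] that(2),
        of "\<lambda>j x. g (\<nu> j) (translate (\<tau> j) x)" "\<alpha> i"] approx[OF that(1)] int_g \<nu>
    by force
  \<comment> \<open>Outside \<open>V\<close>, a cylinder not in \<open>W\<close> keeps about a
    quarter of its measure, up to errors in \<epsilon>.\<close>
  have step: "measure M (A i - V) \<le> 2 * \<epsilon> + \<epsilon> / \<delta> + 1 / 4 * measure M (A i)" if i: "i \<in> R - W" for i
  proof -
    have iR: "i \<in> R" using i by simp
    \<comment> \<open>Testing on the complement of \<open>A i\<close>, where the indicator vanishes,
      bounds the misplaced mass.\<close>
    have bad: "(\<Sum>j\<in>Q. \<alpha> i j * b (\<nu> j) i (\<tau> j)) \<le> \<epsilon>"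
      using est[OF iR, of "space M - A i"] iR by (simp add: b_def)
    have "A i \<inter> space M = A i" using A(1)[OF iR] sets.sets_into_space by blast
    moreover have "(\<integral>x. indicator (space M) x * g (\<nu> j) (translate (\<tau> j) x) \<partial>M) = I (\<nu> j)" if "j \<in> Q" for j
      unfolding I_translate[OF \<nu>[OF that], of "\<tau> j", symmetric]
      by (intro Bochner_Integration.integral_cong) auto
    ultimately have total: "(\<Sum>j\<in>Q. \<alpha> i j * I (\<nu> j)) \<le> measure M (A i) + \<epsilon>"
      using est[OF iR, of "space M"] by simp
    have "measure M (A i - V) = measure M (A i \<inter> (space M - V))"
      using A(1)[OF iR] sets.sets_into_space by (intro arg_cong[where f = "measure M"]) blast
    also have "\<dots> \<le> (\<Sum>j\<in>Q. \<alpha> i j * (\<integral>x. indicator (space M - V) x * g (\<nu> j) (translate (\<tau> j) x) \<partial>M)) + \<epsilon>"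
      using est[OF iR, of "space M - V"] by simp
    also have "(\<Sum>j\<in>Q. \<alpha> i j * (\<integral>x. indicator (space M - V) x * g (\<nu> j) (translate (\<tau> j) x) \<partial>M))
        \<le> (\<Sum>j\<in>Q. \<alpha> i j * (b (\<nu> j) i (\<tau> j) / \<delta> + 1 / 4 * I (\<nu> j)))"
    proof (intro sum_mono mult_left_mono \<alpha> iR)
      fix j assume j: "j \<in> Q"
      let ?m = "\<nu> j" and ?t = "\<tau> j"
      have m: "?m \<in> H" using \<nu> j by simp
      show "(\<integral>x. indicator (space M - V) x * g ?m (translate ?t x) \<partial>M) \<le> b ?m i ?t / \<delta> + 1 / 4 * I ?m"
      proof (cases "good ?m i ?t")
        case True
        then have t: "?t \<in> \<Lambda> ?m" using j iR by (auto simp: \<Lambda>_def)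
        then have "\<iota> ?m ?t = i"
          using \<iota>[OF t] good_unique[OF m] True iR by blast
        then have "C \<le> card (\<Lambda> ?m)"
          using i t m by (force simp: W_def not_less)
        then have "U ?m \<subseteq> V" using m by (auto simp: V_def)
        then have "(\<integral>x. indicator (space M - V) x * g ?m (translate ?t x) \<partial>M)
            \<le> (\<integral>x. indicator (space M - U ?m) x * g ?m (translate ?t x) \<partial>M)"
          using int_ind[OF m] U(1)[OF m] g(2)[OF m]
          by (intro integral_mono) (auto split: split_indicator)
        also have "\<dots> \<le> 1 / 4 * I ?m" by (rule U(3)[OF m t])
        finally show ?thesis using b_nonneg[OF m, of i ?t] \<delta> by (simp add: add_increasing)
      next
        case False
        then have "I ?m \<le> b ?m i ?t / \<delta>" using \<delta> by (simp add: good_def field_simps)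
        moreover have "(\<integral>x. indicator (space M - V) x * g ?m (translate ?t x) \<partial>M) \<le> I ?m"
          by (rule ind_le[OF m]) measurable
        ultimately show ?thesis using I_nonneg[OF m] by linarith
      qed
    qed
    also have "\<dots> = (\<Sum>j\<in>Q. \<alpha> i j * b (\<nu> j) i (\<tau> j)) / \<delta> + 1 / 4 * (\<Sum>j\<in>Q. \<alpha> i j * I (\<nu> j))"
      by (simp add: sum_distrib_left sum_divide_distrib algebra_simps sum.distrib)
    also have "\<dots> \<le> \<epsilon> / \<delta> + 1 / 4 * (measure M (A i) + \<epsilon>)"
      using bad total \<delta> by (intro add_mono divide_right_mono mult_left_mono) auto
    finally show ?thesis using \<epsilon> by (simp add: add_divide_distrib)
  qed

  have A_sum: "(\<Sum>i\<in>R. measure M (A i)) = 1"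
    using A R prob_space by (subst finite_measure_finite_Union[symmetric]) auto
  have "1 - measure M V = measure M (space M - V)"
    by (simp add: prob_compl)
  also have "\<dots> \<le> (\<Sum>i\<in>R. measure M (A i - V))"
    unfolding A(3)[symmetric] UN_extend_simps
    using R A(1) by (intro finite_measure_subadditive_finite) auto
  also have "\<dots> = (\<Sum>i\<in>W. measure M (A i - V)) + (\<Sum>i\<in>R - W. measure M (A i - V))"
    by (subst sum.subset_diff[OF WR R]) (rule add.commute)
  also have "(\<Sum>i\<in>W. measure M (A i - V)) \<le> (\<Sum>i\<in>W. a)"
  proof (rule sum_mono)
    fix i assume "i \<in> W"
    then have i: "i \<in> R" using WR by blast
    have "measure M (A i - V) \<le> measure M (A i)"
      using A(1)[OF i] by (intro finite_measure_mono) auto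
    then show "measure M (A i - V) \<le> a" using A_small[OF i] by simp
  qed
  also have "(\<Sum>i\<in>W. a) \<le> real (card H * C) * a"
    using cardW a by (simp only: sum_constant) (intro mult_right_mono, auto simp del: of_nat_mult)
  also have "(\<Sum>i\<in>R - W. measure M (A i - V))
      \<le> (\<Sum>i\<in>R - W. 2 * \<epsilon> + \<epsilon> / \<delta> + 1 / 4 * measure M (A i))"
    by (intro sum_mono step)
  also have "\<dots> \<le> (\<Sum>i\<in>R. 2 * \<epsilon> + \<epsilon> / \<delta> + 1 / 4 * measure M (A i))"
    using R \<epsilon> \<delta> by (intro sum_mono2) auto
  also have "\<dots> = real (card R) * (2 * \<epsilon> + \<epsilon> / \<delta>) + 1 / 4"
    by (simp only: sum.distrib sum_constant sum_distrib_left[symmetric] A_sum) (simp add: algebra_simps)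
  finally show ?thesis using V_le by simp
qed

end

section \<open>Choice of parameters and conclusion\<close>

text \<open>First \<theta> is fixed with \<open>q + \<theta> < 1\<close>; then, as \<delta> tends to
  0, \<open>\<theta> powr (4 * \<delta>)\<close> tends to 1 and exceeds
  \<open>q + \<theta>\<close>.\<close>

lemma exists_ball_parameters:
  fixes q :: real
  assumes q: "0 \<le> q" "q < 1"
  obtains \<theta> \<delta> where "0 < \<theta>" "\<theta> \<le> 1" "0 < \<delta>" "\<delta> \<le> 1 / 2"
    "0 < (q + \<theta>) / \<theta> powr (4 * \<delta>)" "(q + \<theta>) / \<theta> powr (4 * \<delta>) < 1"
proof -
  define \<theta> where "\<theta> = (1 - q) / 2"
  define u where "u = q + \<theta>"
  \<comment> \<open>The exponent with \<open>\<theta> powr d = u\<close>; an exponent of at most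
    \<open>d / 2\<close> then yields at least \<open>sqrt u\<close>, which is larger than
    \<open>u\<close>.\<close>
  define d where "d = ln u / ln \<theta>"
  define \<delta> where "\<delta> = min (1 / 2) (d / 8)"
  have \<theta>: "0 < \<theta>" "\<theta> < 1" and u: "0 < u" "u < 1"
    using q by (auto simp: \<theta>_def u_def field_simps)
  have d: "0 < d" using \<theta> u by (simp add: d_def divide_neg_neg)
  have "sqrt u = \<theta> powr (d / 2)"
    using \<theta> u by (simp add: d_def powr_def flip: powr_half_sqrt)
  also have "\<dots> \<le> \<theta> powr (4 * \<delta>)"
    using \<theta> by (intro powr_mono') (auto simp: \<delta>_def)
  finally have "sqrt u \<le> \<theta> powr (4 * \<delta>)" .
  moreover have "u < sqrt u"
    using u by (intro real_less_rsqrt) (simp add: power2_eq_square)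
  ultimately have "u < \<theta> powr (4 * \<delta>)" by simp
  then show thesis
    using \<theta> u d by (intro that[of \<theta> \<delta>]) (auto simp: \<delta>_def u_def[symmetric])
qed

theorem proposition3p2:
  fixes k n :: nat and p :: "nat \<Rightarrow> real"
  assumes "k \<ge> 2"
    and "\<And>i. i \<in> {1..k} \<Longrightarrow> p i > 0"
    and "(\<Sum>i=1..k. p i) = 1"
    and "n \<ge> 1"
  shows "\<not> AT n (bernoulli k p) shift_map"
proof
  assume AT: "AT n (bernoulli k p) shift_map"
  define q where "q = Max (p ` {1..k})"
  have p_le: "p i \<le> q" if "i \<in> {1..k}" for i
    unfolding q_def using that by (intro Max_ge) auto
  have "q \<in> p ` {1..k}"
    unfolding q_def using assms(1) by (intro Max_in) auto
  then obtain i where i: "i \<in> {1..k}" "q = p i" by auto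
  \<comment> \<open>A second letter of positive probability forces \<open>q < 1\<close>.\<close>
  define i' where "i' = (if i = 1 then 2 else 1 :: nat)"
  have i': "i' \<in> {1..k}" "i' \<noteq> i" using assms(1) by (auto simp: i'_def)
  have "p i + p i' = (\<Sum>j\<in>{i, i'}. p j)" using i' by simp
  also have "\<dots> \<le> (\<Sum>j=1..k. p j)"
    using i i' assms(2) by (intro sum_mono2) (auto intro: less_imp_le)
  finally have q: "0 \<le> q" "q < 1"
    using assms(2)[OF i(1)] assms(2)[OF i'(1)] assms(3) i by auto
  interpret bernoulli_shift k p q
    using assms(2,3) p_le q by unfold_locales (auto intro: less_imp_le)

  obtain \<theta> \<delta> where \<theta>: "0 < \<theta>" "\<theta> \<le> 1" and \<delta>: "0 < \<delta>" "\<delta> \<le> 1 / 2"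
    and \<rho>: "0 < (q + \<theta>) / \<theta> powr (4 * \<delta>)" "(q + \<theta>) / \<theta> powr (4 * \<delta>) < 1"
    using exists_ball_parameters[OF q] .
  have "(\<lambda>l. real l * ((q + \<theta>) / \<theta> powr (4 * \<delta>)) ^ l) \<longlonglongrightarrow> 0"
    using \<rho> by (intro powser_times_n_limit_0) (simp add: abs_less_iff)
  then have "eventually (\<lambda>l. real l * ((q + \<theta>) / \<theta> powr (4 * \<delta>)) ^ l < 1 / (4 * real n)) sequentially"
    using assms(4) by (intro order_tendstoD(2)) auto
  then obtain C where C: "\<And>l. C \<le> l \<Longrightarrow> real l * ((q + \<theta>) / \<theta> powr (4 * \<delta>)) ^ l \<le> 1 / (4 * real n)"
    unfolding eventually_sequentially by (meson less_imp_le)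
  \<comment> \<open>This bounds the total measure of \<open>n * C\<close> cylinders by 1/4;
    \<open>C + 1\<close> keeps the denominator positive.\<close>
  obtain l where l: "q ^ l < 1 / (4 * real n * (real C + 1))"
    using real_arch_pow_inv[of "1 / (4 * real n * (real C + 1))" q] q assms(4) by auto

  define words where "words = ({..l} \<rightarrow>\<^sub>E {1..k})"
  have fin: "finite words" by (auto simp: words_def intro: finite_PiE)
  define r where "r = card words"
  obtain w where w: "bij_betw w {1..r} words"
    using ex_bij_betw_nat_finite_1[OF fin] unfolding r_def by blast
  have w_letter: "w i j \<in> {1..k}" if "i \<in> {1..r}" "j \<le> l" for i j
    using bij_betwE[OF w] that by (auto simp: words_def PiE_def Pi_def)
  define A where "A i = cylinder k l (w i) 0" for i
  have A_sets: "A i \<in> sets M" if "i \<in> {1..r}" for i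
    unfolding sets_bernoulli A_def cylinders_def using w_letter[OF that]
    by (intro sigma_sets.Basic) blast
  have A_small: "measure M (A i) \<le> q ^ l" if "i \<in> {1..r}" for i
  proof -
    have "measure M (A i) = (\<Prod>j\<le>l. p (w i j))"
      unfolding A_def measure_def
      using w_letter[OF that] p_nonneg
      by (subst emeasure_bernoulli_cylinder[OF p_nonneg p_sum]) (auto intro!: enn2real_ennreal prod_nonneg)
    also have "\<dots> \<le> (\<Prod>j\<le>l. q)"
      using w_letter[OF that] p_nonneg p_le by (intro prod_mono) auto
    \<comment> \<open>The words have \<open>l + 1\<close> letters; the surplus factor
      \<open>q\<close> is at most 1.\<close>
    also have "\<dots> \<le> q ^ l"
      using q by (simp add: mult_left_le_one_le)
    finally show ?thesis .
  qed
  have A_disjoint: "disjoint_family_on A {1..r}"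
    unfolding disjoint_family_on_def
  proof (intro ballI impI, rule ccontr)
    fix i i' assume i: "i \<in> {1..r}" "i' \<in> {1..r}" "i \<noteq> i'" and "A i \<inter> A i' \<noteq> {}"
    then have "w i j = w i' j" if "j \<in> {..l}" for j
      using that by (auto simp: A_def cylinder_def)
    moreover have "w i \<in> words" "w i' \<in> words" using bij_betwE[OF w] i by auto
    ultimately have "w i = w i'"
      unfolding words_def by (intro PiE_ext) auto
    then show False using bij_betw_imp_inj_on[OF w] i by (auto dest: inj_onD)
  qed
  have A_cover: "(\<Union>i\<in>{1..r}. A i) = space M"
  proof
    show "space M \<subseteq> (\<Union>i\<in>{1..r}. A i)"
    proof
      fix x assume x: "x \<in> space M"
      then have "restrict (\<lambda>j. x (int j)) {..l} \<in> words"
        by (auto simp: words_def space_bernoulli shift_space_def)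
      then obtain i where i: "i \<in> {1..r}" "w i = restrict (\<lambda>j. x (int j)) {..l}"
        using w by (metis bij_betw_imp_surj_on imageE)
      then have "x \<in> A i" using x by (simp add: A_def cylinder_def space_bernoulli)
      then show "x \<in> (\<Union>i\<in>{1..r}. A i)" using i by blast
    qed
  qed (auto simp: A_def cylinder_def space_bernoulli)

  \<comment> \<open>Chosen so that \<open>r * (2 * \<epsilon> + \<epsilon> / \<delta>)\<close>
    equals \<open>r / (8 * (r + 1))\<close>, which is below 1/4.\<close>
  define \<epsilon> where "\<epsilon> = 1 / (8 * (real r + 1) * (2 + 1 / \<delta>))"
  have \<epsilon>: "0 < \<epsilon>" using \<delta> by (simp add: \<epsilon>_def add_pos_pos)
  have "\<forall>i\<in>{1..r}. indicator (A i) \<in> L1_pos M"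
    using A_sets by (auto simp: L1_pos_def less_top[symmetric])
  from AT[unfolded AT_def, THEN spec, THEN mp, OF \<epsilon>, THEN spec[of _ r],
      THEN spec[of _ "\<lambda>i. indicator (A i)"], THEN mp, OF this]
  obtain g N \<alpha> t where
      g: "\<forall>m\<in>{1..n}. g m \<in> L1_pos M"
    and \<alpha>: "\<forall>m\<in>{1..n}. \<forall>i\<in>{1..r}. \<forall>j\<in>{1..N::nat}. 0 \<le> \<alpha> m i j"
    and approx: "\<forall>i\<in>{1..r}. L1_norm M (\<lambda>x. indicator (A i) x -
        (\<Sum>m=1..n. \<Sum>j=1..N. \<alpha> m i j * g m (int_iter M shift_map (t m j) x))) < \<epsilon>"
    by (elim exE conjE) (rule that)
  \<comment> \<open>Membership in \<open>L1_pos\<close> gives nonnegativity only almost everywhere,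
    whereas \<open>approximation_bound\<close> asks for it everywhere. The truncation changes none
    of the finitely many translates outside a null set.\<close>
  define h where "h m x = max 0 (g m x)" for m x
  have h_int: "integrable M (h m)" if "m \<in> {1..n}" for m
    using g that unfolding h_def[abs_def] by (intro integrable_max) (auto simp: L1_pos_def)
  have [measurable]: "g m \<in> borel_measurable M" if "m \<in> {1..n}" for m
    using g that by (auto simp: L1_pos_def)
  have approx': "(\<integral>x. \<bar>indicator (A i) x - (\<Sum>(m, j)\<in>{1..n} \<times> {1..N}. \<alpha> m i j * h m (translate (t m j) x))\<bar> \<partial>M) \<le> \<epsilon>"
    if i: "i \<in> {1..r}" for i
  proof -
    have "AE x in M. \<forall>(m, j)\<in>{1..n} \<times> {1..N}. 0 \<le> g m (translate (t m j) x)"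
      using g by (intro AE_finite_allI) (auto simp: L1_pos_def intro!: AE_translate)
    then have "AE x in M. \<bar>indicator (A i) x - (\<Sum>(m, j)\<in>{1..n} \<times> {1..N}. \<alpha> m i j * h m (translate (t m j) x))\<bar>
      = \<bar>indicator (A i) x - (\<Sum>m=1..n. \<Sum>j=1..N. \<alpha> m i j * g m (int_iter M shift_map (t m j) x))\<bar>"
      using AE_space
    proof eventually_elim
      case (elim x)
      have "(\<Sum>(m, j)\<in>{1..n} \<times> {1..N}. \<alpha> m i j * h m (translate (t m j) x))
        = (\<Sum>(m, j)\<in>{1..n} \<times> {1..N}. \<alpha> m i j * g m (int_iter M shift_map (t m j) x))"
        using elim by (intro sum.cong) (auto simp: h_def int_iter_shift_map)
      then show ?case by (simp add: sum.cartesian_product)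
    qed
    then have "(\<integral>x. \<bar>indicator (A i) x - (\<Sum>(m, j)\<in>{1..n} \<times> {1..N}. \<alpha> m i j * h m (translate (t m j) x))\<bar> \<partial>M)
      = L1_norm M (\<lambda>x. indicator (A i) x - (\<Sum>m=1..n. \<Sum>j=1..N. \<alpha> m i j * g m (int_iter M shift_map (t m j) x)))"
      unfolding L1_norm_def
    proof (rule integral_cong_AE[rotated 2])
      show "(\<lambda>x. \<bar>indicator (A i) x - (\<Sum>(m, j)\<in>{1..n} \<times> {1..N}. \<alpha> m i j * h m (translate (t m j) x))\<bar>)
          \<in> borel_measurable M"
        using A_sets[OF i] unfolding h_def by (auto simp flip: sum.cartesian_product)
      have "(\<lambda>x. \<bar>indicator (A i) x - (\<Sum>m=1..n. \<Sum>j=1..N. \<alpha> m i j * g m (translate (t m j) x))\<bar>)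
          \<in> borel_measurable M"
        using A_sets[OF i] by auto
      then show "(\<lambda>x. \<bar>indicator (A i) x - (\<Sum>m=1..n. \<Sum>j=1..N. \<alpha> m i j * g m (int_iter M shift_map (t m j) x))\<bar>)
          \<in> borel_measurable M"
        by (rule measurable_cong[THEN iffD1, rotated]) (simp add: int_iter_shift_map)
    qed
    then show ?thesis using approx i by (simp add: less_imp_le)
  qed
  \<comment> \<open>Both subtracted terms are at most 1/4, so the left side is at least 1/2, while
    the right side is less than 1/2.\<close>
  have "1 - real (card {1..n}) * real C * q ^ l - real (card {1..n}) * (1 / (4 * real n))
      \<le> real (card {1..r}) * (2 * \<epsilon> + \<epsilon> / \<delta>) + 1 / 4"
  proof (rule approximation_bound[where A = A and g = h and Q = "{1..n} \<times> {1..N}" and \<nu> = fst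
        and \<tau> = "\<lambda>(m, j). t m j" and \<alpha> = "\<lambda>i (m, j). \<alpha> m i j" and c = "\<lambda>i. w i 0" and \<theta> = \<theta>])
    show "(\<integral>x. \<bar>indicator (A i) x - (\<Sum>j\<in>{1..n} \<times> {1..N}. (case j of (m, j) \<Rightarrow> \<alpha> m i j)
        * h (fst j) (translate (case j of (m, j) \<Rightarrow> t m j) x))\<bar> \<partial>M) \<le> \<epsilon>" if "i \<in> {1..r}" for i
      using approx'[OF that] by (simp add: case_prod_unfold)
    show "x 0 = w i 0" if "i \<in> {1..r}" "x \<in> A i" for i x
      using that by (auto simp: A_def cylinder_def)
    show "0 \<le> (case j of (m, j) \<Rightarrow> \<alpha> m i j)" if "i \<in> {1..r}" "j \<in> {1..n} \<times> {1..N}" for i j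
      using \<alpha> that by (auto simp: case_prod_unfold mem_Times_iff)
    show "0 \<le> h m x" for m x
      by (simp add: h_def)
    show "0 \<le> \<epsilon>" "0 \<le> q ^ l"
      using \<epsilon> q by auto
  qed ((fact A_sets A_disjoint A_cover A_small h_int \<theta> \<delta> C | (auto)[1])+)
  moreover have "real n * real C * q ^ l \<le> 1 / 4"
  proof -
    have "real n * real C * q ^ l \<le> real n * (real C + 1) * q ^ l"
      using q by (intro mult_right_mono mult_left_mono) auto
    also have "\<dots> \<le> real n * (real C + 1) * (1 / (4 * real n * (real C + 1)))"
      using l by (intro mult_left_mono) auto
    also have "\<dots> = 1 / 4"
    proof -
      have "real n \<noteq> 0" "real C + 1 \<noteq> 0" using assms(4) by auto
      then show ?thesis by simp
    qed
    finally show ?thesis .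
  qed
  moreover have "real r * (2 * \<epsilon> + \<epsilon> / \<delta>) < 1 / 4"
  proof -
    have "real r * (2 * \<epsilon> + \<epsilon> / \<delta>) = real r * (\<epsilon> * (2 + 1 / \<delta>))"
      by (simp add: algebra_simps)
    also have "\<epsilon> * (2 + 1 / \<delta>) = 1 / (8 * (real r + 1))"
    proof -
      have "2 + 1 / \<delta> \<noteq> 0" using \<delta> by (simp add: add_pos_pos less_imp_neq[symmetric])
      then show ?thesis by (simp add: \<epsilon>_def)
    qed
    also have "real r * (1 / (8 * (real r + 1))) < 1 / 4"
      by (simp add: field_simps)
    finally show ?thesis .
  qed
  ultimately show False
    using assms(4) by simp
qed

end
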